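(* Let $d\ge 1$ and $\mu\ge 1$. For every Any Fit packing algorithm $\mathcal{A}$ for the MinUsageTime Dynamic Vector Bin Packing problem in $d$ dimensions, the competitive ratio of $\mathcal{A}$ is at least $(\mu+1)d$; i.e., for every $\delta>0$ there is an instance $\mathcal{R}$ whose ratio of maximum to minimum item duration is $\mu$ such that $\mathsf{cost}(\mathcal{A},\mathcal{R}) \ge ((\mu+1)d-\delta)\,\mathsf{OPT}(\mathcal{R})$.
   Context: MinUsageTime Dynamic Vector Bin Packing (non-clairvoyant, online, no repacking): an instance is a finite list $\mathcal{R}$ of items; each item $r$ has arrival time $a(r)\ge 0$, departure time $e(r)>a(r)$, and size $\mathbf{s}(r)\in[0,1]^d$. Its active interval is $I(r)=[a(r),e(r))$ with duration $e(r)-a(r)$. Bins have capacity $1$ in each of the $d$ coordinates. Items are revealed in order of arrival (ties in a given order); on arrival, an item must be irrevocably placed into a bin such that the total size of items currently active in that bin stays $\le 1$ in every coordinate; the departure time is unknown at arrival. A bin is open while it contains an active item; once all its items have departed it is closed and never used again. If bin $B_i$ receives item set $R_i$, the cost of algorithm $\mathcal{A}$ is $\mathsf{cost}(\mathcal{A},\mathcal{R})=\sum_i \mathrm{span}(R_i)$, where $\mathrm{span}(S)$ is the Lebesgue measure of $\bigcup_{r\in S} I(r)$. $\mathsf{OPT}(\mathcal{R})=\int \mathsf{OPT}(\mathcal{R},t)\,dt$, where $\mathsf{OPT}(\mathcal{R},t)$ is the minimum number of unit-capacity bins into which the items active at time $t$ can be packed (offline, repacking allowed). An Any Fit packing algorithm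 is any online algorithm of this form that opens a new bin for an arriving item only when the item cannot be accommodated in any currently open bin (the choice among open bins that fit is arbitrary). *)

theory Defs
  imports "HOL-Analysis.Analysis" "HOL-Library.Extended_Real"
begin

record ('d::finite) item =
  arrival :: real
  departure :: real
  item_size :: "real^'d"

definition active_interval :: "'d::finite item \<Rightarrow> real set" where
  "active_interval r = {arrival r..<departure r}"

definition duration :: "'d::finite item \<Rightarrow> real" where
  "duration r = departure r - arrival r"

text \<open>An instance lists the items in the order in which they are revealed; the order of the list
  breaks ties between equal arrival times. Items are identified by their position in the list, so
  that several items may carry identical data.\<close>

definition valid_item :: "'d::finite item \<Rightarrow> bool" where
  "valid_item r \<longleftrightarrow> 0 \<le> arrival r \<and> arrival r < departure r \<and>
     (\<forall>i. 0 \<le> item_size r $ i \<and> item_size r $ i \<le> 1)"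

definition valid_instance :: "'d::finite item list \<Rightarrow> bool" where
  "valid_instance R \<longleftrightarrow> (\<forall>r\<in>set R. valid_item r) \<and> sorted (map arrival R)"

text \<open>Only meaningful for nonempty instances.\<close>

definition duration_ratio :: "'d::finite item list \<Rightarrow> real" where
  "duration_ratio R = Max (duration ` set R) / Min (duration ` set R)"

definition item_span :: "'d::finite item set \<Rightarrow> real" where
  "item_span S = measure lborel (\<Union>r\<in>S. active_interval r)"

definition active_items :: "'d::finite item list \<Rightarrow> real \<Rightarrow> nat set" where
  "active_items R t = {j. j < length R \<and> t \<in> active_interval (R ! j)}"

definition OPT_at :: "'d::finite item list \<Rightarrow> real \<Rightarrow> nat" where
  "OPT_at R t = (LEAST m. \<exists>f :: nat \<Rightarrow> nat. (\<forall>j\<in>active_items R t. f j < m) \<and>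
     (\<forall>b<m. \<forall>i. (\<Sum>j | j \<in> active_items R t \<and> f j = b. item_size (R ! j) $ i) \<le> 1))"

definition OPT :: "'d::finite item list \<Rightarrow> real" where
  "OPT R = (\<integral>t. real (OPT_at R t) \<partial>lborel)"

text \<open>What a non-clairvoyant algorithm has seen when item \<open>k\<close> arrives: arrival times and sizes of
  the items \<open>0, \<dots>, k\<close>, and the departure times of precisely those among them that have already
  departed (\<open>None\<close> for the others, in particular for item \<open>k\<close>). An online algorithm maps this
  information to the label of a bin. Since the earlier views can be recovered from the current one,
  the algorithm's own previous choices need not be recorded.\<close>

type_synonym 'd view = "(real \<times> (real^'d) \<times> real option) list"

type_synonym 'd algorithm = "'d view \<Rightarrow> nat"

definition view_at :: "'d::finite item list \<Rightarrow> nat \<Rightarrow> 'd view" where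
  "view_at R k =
     map (\<lambda>r. (arrival r, item_size r,
               if departure r \<le> arrival (R ! k) then Some (departure r) else None))
         (take (Suc k) R)"

definition bin_of :: "'d::finite algorithm \<Rightarrow> 'd item list \<Rightarrow> nat \<Rightarrow> nat" where
  "bin_of A R k = A (view_at R k)"

text \<open>The state of the bins immediately before item \<open>k\<close> is placed.\<close>

definition used_bins :: "'d::finite algorithm \<Rightarrow> 'd item list \<Rightarrow> nat \<Rightarrow> nat set" where
  "used_bins A R k = bin_of A R ` {..<k}"

definition bin_content :: "'d::finite algorithm \<Rightarrow> 'd item list \<Rightarrow> nat \<Rightarrow> nat \<Rightarrow> nat set" where
  "bin_content A R k b =
     {j. j < k \<and> bin_of A R j = b \<and> arrival (R ! k) \<in> active_interval (R ! j)}"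

definition open_bins :: "'d::finite algorithm \<Rightarrow> 'd item list \<Rightarrow> nat \<Rightarrow> nat set" where
  "open_bins A R k = {b. bin_content A R k b \<noteq> {}}"

definition fits :: "'d::finite algorithm \<Rightarrow> 'd item list \<Rightarrow> nat \<Rightarrow> nat \<Rightarrow> bool" where
  "fits A R k b \<longleftrightarrow>
     (\<forall>i. (\<Sum>j\<in>bin_content A R k b. item_size (R ! j) $ i) + item_size (R ! k) $ i \<le> 1)"

text \<open>Each item goes into an open bin with enough room or into a bin never used before; a bin that
  has been closed is not reused. Loads can only grow at arrivals, so checking the capacity there
  suffices.\<close>

definition packing_algorithm :: "'d::finite algorithm \<Rightarrow> bool" where
  "packing_algorithm A \<longleftrightarrow> (\<forall>R k. valid_instance R \<and> k < length R \<longrightarrow>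
     (bin_of A R k \<in> open_bins A R k \<or> bin_of A R k \<notin> used_bins A R k) \<and>
     fits A R k (bin_of A R k))"

definition any_fit_algorithm :: "'d::finite algorithm \<Rightarrow> bool" where
  "any_fit_algorithm A \<longleftrightarrow> packing_algorithm A \<and>
     (\<forall>R k. valid_instance R \<and> k < length R \<and> bin_of A R k \<notin> used_bins A R k \<longrightarrow>
        (\<forall>b\<in>open_bins A R k. \<not> fits A R k b))"

definition cost :: "'d::finite algorithm \<Rightarrow> 'd item list \<Rightarrow> real" where
  "cost A R = (\<Sum>b\<in>bin_of A R ` {..<length R}.
     item_span {R ! j | j. j < length R \<and> bin_of A R j = b})"

text \<open>The competitive ratio as a function of the ratio \<open>\<mu>\<close> of maximum to minimum item duration:
  the least \<open>c\<close> with cost at most \<open>c\<close> times the optimum (\<open>\<infinity>\<close> if there is none).\<close>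

definition competitive_ratio :: "'d::finite algorithm \<Rightarrow> real \<Rightarrow> ereal" where
  "competitive_ratio A \<mu> = Inf {ereal c | c. \<forall>R. valid_instance R \<and> R \<noteq> [] \<and>
     duration_ratio R = \<mu> \<longrightarrow> cost A R \<le> c * OPT R}"

end

theory Submission imports Defs begin

text \<open>Write \<open>D\<close> for the dimension, \<open>N = D k\<close> and \<open>\<eta> = 1/(6 D k)\<close>. At time \<open>0\<close> arrive \<open>N\<close> pairs of
  items of duration \<open>1\<close>. The \<open>b\<close>-th pair consists of a big item of size \<open>1 - 3 D \<eta>\<close> and a filler of
  size \<open>(3 D - 1) \<eta>\<close> in coordinate \<open>b mod D\<close>, both of size \<open>2 \<eta>\<close> in all others. The pair leaves room
  \<open>\<eta>\<close> in its own coordinate, whereas all these items need at least \<open>2 \<eta>\<close> in every coordinate; hence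
  every pair occupies a bin of its own. Shortly before time \<open>1\<close> arrive \<open>N\<close> tiny items of size \<open>\<eta>\<close> in
  every coordinate and duration \<open>\<mu>\<close>. Each bin has room for precisely one of them, so that all \<open>N\<close> bins
  stay open for a time close to \<open>1 + \<mu>\<close>. The optimum packs \<open>D\<close> big items for different coordinates
  together, and all fillers and tiny items into one bin: it needs \<open>k + 1\<close> bins up to time \<open>1\<close> and one
  bin afterwards.\<close>

definition peak :: "'d::finite \<Rightarrow> real \<Rightarrow> real \<Rightarrow> real^'d" where
  "peak i x y = (\<chi> j. if j = i then x else y)"

lemma peak_nth [simp]: "peak i x y $ j = (if j = i then x else y)"
  by (simp add: peak_def)

section \<open>Criteria for fitting, rejection and small packings\<close>

lemma finite_bin_content [simp]: "finite (bin_content A R k b)"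
  unfolding bin_content_def by simp

text \<open>Sizes are nonnegative, so loads grow with the content. Hence a superset of the content
  suffices to show that an item fits, and a subset suffices in the next lemma to show that it does
  not.\<close>

lemma fits_if_content_subset:
  assumes "bin_content A R k b \<subseteq> S" and "finite S"
    and "\<And>j i. j \<in> S \<Longrightarrow> 0 \<le> item_size (R ! j) $ i"
    and "\<And>i. (\<Sum>j\<in>S. item_size (R ! j) $ i) + item_size (R ! k) $ i \<le> 1"
  shows "fits A R k b"
  unfolding fits_def
proof
  fix i
  have "(\<Sum>j\<in>bin_content A R k b. item_size (R ! j) $ i) \<le> (\<Sum>j\<in>S. item_size (R ! j) $ i)"
    using assms by (intro sum_mono2) auto
  then show "(\<Sum>j\<in>bin_content A R k b. item_size (R ! j) $ i) + item_size (R ! k) $ i \<le> 1"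
    using assms(4)[of i] by linarith
qed

lemma not_fits_if_subset_content:
  assumes "S \<subseteq> bin_content A R k b"
    and "\<And>j. j < k \<Longrightarrow> 0 \<le> item_size (R ! j) $ i"
    and "(\<Sum>j\<in>S. item_size (R ! j) $ i) + item_size (R ! k) $ i > 1"
  shows "\<not> fits A R k b"
proof -
  have "(\<Sum>j\<in>S. item_size (R ! j) $ i) \<le> (\<Sum>j\<in>bin_content A R k b. item_size (R ! j) $ i)"
    using assms(1,2) by (intro sum_mono2) (auto simp: bin_content_def)
  then have "1 < (\<Sum>j\<in>bin_content A R k b. item_size (R ! j) $ i) + item_size (R ! k) $ i"
    using assms(3) by linarith
  then show ?thesis unfolding fits_def by (auto simp: not_le)
qed

lemma OPT_at_le:
  assumes "\<And>j. j \<in> active_items R t \<Longrightarrow> f j < m"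
    and "\<And>b i. b < m \<Longrightarrow> (\<Sum>j | j \<in> active_items R t \<and> f j = b. item_size (R ! j) $ i) \<le> 1"
  shows "OPT_at R t \<le> m"
  unfolding OPT_at_def by (rule Least_le) (use assms in blast)

lemma OPT_nonneg: "0 \<le> OPT R"
  unfolding OPT_def by simp

section \<open>The adversarial instance\<close>

locale any_fit_adversary =
  fixes A :: "'d::finite algorithm" and \<mu> :: real and k :: nat and h :: "nat \<Rightarrow> 'd"
  assumes mu: "\<mu> \<ge> 1" and any_fit: "any_fit_algorithm A" and k_pos: "k > 0"
    and bij_h: "bij_betw h {..<CARD('d)} UNIV"
begin

definition N :: nat where "N = k * CARD('d)"

text \<open>Chosen so that the tiny items sum to 1/6 in every coordinate, which is the room that the
  fillers, of total at most 5/6, leave in a single bin.\<close>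

definition \<eta> :: real where "\<eta> = 1 / (6 * real N)"

text \<open>The overlap between the two waves costs the adversary \<tau> per bin, hence only N *
  \<tau> = D in total, independently of k.\<close>

definition \<tau> :: real where "\<tau> = 1 / real k"

text \<open>The own coordinate of pair \<open>b\<close>. The pairs split into k blocks of D
  consecutive ones, and \<open>h\<close> makes each block run through all coordinates once.\<close>

definition g :: "nat \<Rightarrow> 'd" where "g b = h (b mod CARD('d))"

definition adv_item :: "nat \<Rightarrow> 'd item" where
  "adv_item j =
     (if j < 2 * N then
        \<lparr>arrival = 0, departure = 1, item_size =
           (if even j then peak (g (j div 2)) (1 - 3 * real CARD('d) * \<eta>) (2 * \<eta>)
            else peak (g (j div 2)) ((3 * real CARD('d) - 1) * \<eta>) (2 * \<eta>))\<rparr>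
      else \<lparr>arrival = 1 - \<tau>, departure = 1 - \<tau> + \<mu>, item_size = vec \<eta>\<rparr>)"

definition adv :: "'d item list" where
  "adv = map adv_item [0..<3 * N]"

abbreviation "place \<equiv> bin_of A adv"

lemma card_ge_1: "real CARD('d) \<ge> 1"
  using zero_less_card_finite[where 'a = 'd] by linarith

lemma k_ge_1: "real k \<ge> 1"
  using k_pos by linarith

lemma tau_pos: "0 < \<tau>" and tau_le_1: "\<tau> \<le> 1"
  unfolding \<tau>_def using k_ge_1 by auto

lemma N_pos: "N > 0"
  unfolding N_def using k_pos by simp

lemma eta_pos: "\<eta> > 0"
  unfolding \<eta>_def using N_pos by simp

lemma eta_N: "\<eta> * real N = 1 / 6"
  unfolding \<eta>_def using N_pos by simp

lemma eta_k_card: "\<eta> * real k * real CARD('d) = 1 / 6"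
  using eta_N unfolding N_def by (simp add: mult.assoc)

lemma eta_card: "\<eta> * real CARD('d) \<le> 1 / 6"
proof -
  have "\<eta> * real CARD('d) * 1 \<le> \<eta> * real CARD('d) * real k"
    using k_ge_1 eta_pos by (intro mult_left_mono) auto
  also have "\<eta> * real CARD('d) * real k = \<eta> * real k * real CARD('d)" by simp
  finally show ?thesis unfolding eta_k_card by simp
qed

lemma eta_le: "\<eta> \<le> \<eta> * real CARD('d)"
  using card_ge_1 eta_pos by simp

lemma eta_small: "\<eta> \<le> 1 / 6"
  using eta_le eta_card by linarith

lemma length_adv [simp]: "length adv = 3 * N"
  by (simp add: adv_def)

lemma adv_nth [simp]: "j < 3 * N \<Longrightarrow> adv ! j = adv_item j"
  by (simp add: adv_def)

lemma size_big: "b < N \<Longrightarrow>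
    item_size (adv_item (2 * b)) $ i = (if i = g b then 1 - 3 * (\<eta> * real CARD('d)) else 2 * \<eta>)"
  by (simp add: adv_item_def)

lemma size_filler: "b < N \<Longrightarrow>
    item_size (adv_item (Suc (2 * b))) $ i =
      (if i = g b then 3 * (\<eta> * real CARD('d)) - \<eta> else 2 * \<eta>)"
  by (simp add: adv_item_def algebra_simps)

lemma size_tiny: "2 * N \<le> j \<Longrightarrow> item_size (adv_item j) $ i = \<eta>"
  by (simp add: adv_item_def)

text \<open>In its own coordinate a big item has size at least 1/2, since D \<eta> \<le> 1/6, and a
  filler has size 3 D \<eta> - \<eta> \<ge> 2 \<eta>, since D \<ge> 1.\<close>

lemma size_wave1_ge: "j < 2 * N \<Longrightarrow> 2 * \<eta> \<le> item_size (adv_item j) $ i"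
  using size_big[of "j div 2" i] size_filler[of "j div 2" i] eta_le eta_card
  by (cases "even j") auto

lemma size_nonneg: "0 \<le> item_size (adv_item j) $ i"
proof (cases "j < 2 * N")
  case True
  then show ?thesis using size_wave1_ge[of j i] eta_pos by linarith
next
  case False
  then show ?thesis using size_tiny[of j i] eta_pos by simp
qed

lemma size_le_1: "item_size (adv_item j) $ i \<le> 1"
proof (cases "j < 2 * N")
  case True
  then show ?thesis
    using size_big[of "j div 2" i] size_filler[of "j div 2" i] eta_le eta_card eta_small eta_pos
    by (cases "even j") auto
next
  case False
  then show ?thesis using size_tiny[of j i] eta_small by simp
qed

lemma pair_load: "b < N \<Longrightarrow> item_size (adv_item (2 * b)) $ i + item_size (adv_item (Suc (2 * b))) $ i
    = (if i = g b then 1 - \<eta> else 4 * \<eta>)"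
  by (simp add: size_big size_filler)

lemma arrival_departure_adv:
  "arrival (adv_item j) = (if j < 2 * N then 0 else 1 - \<tau>)"
  "departure (adv_item j) = (if j < 2 * N then 1 else 1 - \<tau> + \<mu>)"
  by (auto simp: adv_item_def)

lemma valid_adv: "valid_instance adv"
proof -
  have "valid_item (adv_item j)" for j
    unfolding valid_item_def using size_nonneg size_le_1 mu tau_pos tau_le_1
    by (auto simp: arrival_departure_adv)
  moreover have "sorted (map arrival adv)"
    unfolding sorted_iff_nth_mono using tau_pos tau_le_1 by (auto simp: arrival_departure_adv)
  ultimately show ?thesis unfolding valid_instance_def by (auto simp: adv_def)
qed

lemma adv_nonempty: "adv \<noteq> []"
  using length_adv N_pos by fastforce

lemma duration_ratio_adv: "duration_ratio adv = \<mu>"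
proof -
  have dur: "duration (adv_item j) = (if j < 2 * N then 1 else \<mu>)" for j
    by (simp add: duration_def arrival_departure_adv)
  have "duration ` set adv = {1, \<mu>}"
  proof
    show "duration ` set adv \<subseteq> {1, \<mu>}" by (auto simp: adv_def dur)
    have "duration (adv_item 0) \<in> duration ` set adv" "duration (adv_item (2 * N)) \<in> duration ` set adv"
      using N_pos by (auto simp: adv_def)
    then show "{1, \<mu>} \<subseteq> duration ` set adv" using N_pos by (auto simp: dur)
  qed
  then show ?thesis unfolding duration_ratio_def using mu by simp
qed

section \<open>Behaviour of the algorithm on the instance\<close>

lemma bin_content_adv:
  assumes "m < 3 * N"
  shows "bin_content A adv m x = {j. j < m \<and> place j = x}"
proof -
  \<comment> \<open>The last arrival, at 1 - \<tau>, precedes every departure, so bins lose nothing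
    while items are still arriving.\<close>
  have "arrival (adv ! m) \<in> active_interval (adv ! j)" if "j < m" for j
    using that assms mu tau_pos tau_le_1 by (auto simp: active_interval_def arrival_departure_adv)
  then show ?thesis unfolding bin_content_def by auto
qed

lemma fits_place: "m < 3 * N \<Longrightarrow> fits A adv m (place m)"
  using any_fit valid_adv unfolding any_fit_algorithm_def packing_algorithm_def by auto

text \<open>The only use of the Any Fit rule itself: a nonempty bin with enough room forbids a new
  bin. Which earlier bin is chosen instead remains arbitrary, so later arguments must exclude the
  unwanted ones by capacity.\<close>

lemma place_used:
  assumes "m < 3 * N" and "j < m" and "fits A adv m (place j)"
  shows "\<exists>i<m. place m = place i"
proof -
  have "place j \<in> open_bins A adv m"
    using assms unfolding open_bins_def by (auto simp: bin_content_adv)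
  then have "place m \<in> used_bins A adv m"
    using any_fit valid_adv assms unfolding any_fit_algorithm_def by (metis length_adv)
  then show ?thesis unfolding used_bins_def by auto
qed

lemma full_pair_rejects:
  assumes "b < N" and "place (Suc (2 * b)) = place (2 * b)" and "Suc (2 * b) < m" and "m < 2 * N"
  shows "place m \<noteq> place (2 * b)"
proof
  assume eq: "place m = place (2 * b)"
  have "\<not> fits A adv m (place (2 * b))"
  proof (rule not_fits_if_subset_content[where S = "{2 * b, Suc (2 * b)}" and i = "g b"])
    show "{2 * b, Suc (2 * b)} \<subseteq> bin_content A adv m (place (2 * b))"
      using assms by (auto simp: bin_content_adv)
    show "0 \<le> item_size (adv ! j) $ g b" if "j < m" for j
      using that assms by (simp add: size_nonneg)
    show "1 < (\<Sum>j\<in>{2 * b, Suc (2 * b)}. item_size (adv ! j) $ g b) + item_size (adv ! m) $ g b"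
      using assms pair_load[of b "g b"] size_wave1_ge[of m "g b"] eta_pos by simp
  qed
  then show False using fits_place[of m] assms eq by simp
qed

text \<open>Induction over pairs. The bins of earlier pairs reject both items of pair
  \<open>m\<close>, so its big item starts a new bin. Its filler fits there, hence may not open
  another bin, and has no other bin to go to.\<close>

lemma wave1:
  "m \<le> N \<Longrightarrow> (\<forall>b<m. place (Suc (2 * b)) = place (2 * b)) \<and> inj_on (\<lambda>b. place (2 * b)) {..<m}"
proof (induction m)
  case 0
  then show ?case by simp
next
  case (Suc m)
  then have m: "m < N" and pairs: "\<And>b. b < m \<Longrightarrow> place (Suc (2 * b)) = place (2 * b)"
    and inj: "inj_on (\<lambda>b. place (2 * b)) {..<m}" by auto
  have earlier: "\<exists>b<m. place j = place (2 * b)" if "j < 2 * m" for j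
    using that pairs[of "j div 2"] by (intro exI[of _ "j div 2"]) (cases "even j"; auto)
  have new: "place j \<noteq> place (2 * m)" if "j < 2 * m" for j
  proof -
    obtain b where "b < m" "place j = place (2 * b)" using earlier \<open>j < 2 * m\<close> by blast
    then show ?thesis using full_pair_rejects[of b "2 * m"] pairs m by auto
  qed
  have "fits A adv (Suc (2 * m)) (place (2 * m))"
  proof (rule fits_if_content_subset[where S = "{2 * m}"])
    show "bin_content A adv (Suc (2 * m)) (place (2 * m)) \<subseteq> {2 * m}"
      using m new by (auto simp: bin_content_adv less_Suc_eq)
    show "(\<Sum>j\<in>{2 * m}. item_size (adv ! j) $ i) + item_size (adv ! Suc (2 * m)) $ i \<le> 1" for i
      using m pair_load[of m i] eta_pos eta_small by auto
  qed (use m size_nonneg in auto)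
  then obtain j where j: "j < Suc (2 * m)" "place (Suc (2 * m)) = place j"
    using place_used[of "Suc (2 * m)" "2 * m"] m by auto
  have "j = 2 * m"
  proof (rule ccontr)
    assume "j \<noteq> 2 * m"
    then obtain b where "b < m" "place j = place (2 * b)" using earlier[of j] j by auto
    then show False using full_pair_rejects[of b "Suc (2 * m)"] pairs m j by auto
  qed
  then have "place (Suc (2 * m)) = place (2 * m)" using j by simp
  moreover have "place (2 * b) \<noteq> place (2 * m)" if "b < m" for b
    using new[of "2 * b"] that by simp
  then have "place (2 * m) \<notin> (\<lambda>b. place (2 * b)) ` {..<m}" by fastforce
  then have "inj_on (\<lambda>b. place (2 * b)) {..<Suc m}"
    using inj by (simp add: lessThan_Suc)
  ultimately show ?case using pairs by (auto simp: less_Suc_eq)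
qed

lemma place_filler: "b < N \<Longrightarrow> place (Suc (2 * b)) = place (2 * b)"
  and inj_place_big: "inj_on (\<lambda>b. place (2 * b)) {..<N}"
  using wave1[of N] by auto

lemma place_wave1: "j < 2 * N \<Longrightarrow> place j = place (2 * (j div 2))"
  using place_filler[of "j div 2"] by (cases "even j") auto

text \<open>A pair together with one tiny item fills its own coordinate exactly, so no bin takes a
  second tiny item. As long as fewer than N have been placed, some pair bin still has room and Any
  Fit cannot open a new bin.\<close>

lemma wave2:
  "m \<le> N \<Longrightarrow> (\<forall>i<m. \<exists>b<N. place (2 * N + i) = place (2 * b)) \<and> inj_on (\<lambda>i. place (2 * N + i)) {..<m}"
proof (induction m)
  case 0
  then show ?case by simp
next
  case (Suc m)
  let ?n = "2 * N + m"
  from Suc have m: "m < N" and old: "\<And>i. i < m \<Longrightarrow> \<exists>b<N. place (2 * N + i) = place (2 * b)"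
    and inj: "inj_on (\<lambda>i. place (2 * N + i)) {..<m}" by auto
  have new: "place (2 * N + i) \<noteq> place ?n" if i: "i < m" for i
  proof
    assume eq: "place (2 * N + i) = place ?n"
    obtain b where b: "b < N" "place (2 * N + i) = place (2 * b)" using old i by blast
    have "\<not> fits A adv ?n (place ?n)"
    proof (rule not_fits_if_subset_content[where S = "{2 * b, Suc (2 * b), 2 * N + i}" and i = "g b"])
      show "{2 * b, Suc (2 * b), 2 * N + i} \<subseteq> bin_content A adv ?n (place ?n)"
        using b i m eq place_filler[of b] by (auto simp: bin_content_adv)
      show "0 \<le> item_size (adv ! j) $ g b" if "j < ?n" for j
        using that m by (simp add: size_nonneg)
      show "1 < (\<Sum>j\<in>{2 * b, Suc (2 * b), 2 * N + i}. item_size (adv ! j) $ g b)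
                + item_size (adv ! ?n) $ g b"
        using b m i pair_load[of b "g b"] size_tiny eta_pos by simp
    qed
    then show False using fits_place[of ?n] m by simp
  qed
  \<comment> \<open>Pigeonhole: \<open>m\<close> tiny items cannot occupy all N pair bins, so some
    pair \<open>b\<close> is still without one.\<close>
  have "card ((\<lambda>i. place (2 * N + i)) ` {..<m}) < card ((\<lambda>b. place (2 * b)) ` {..<N})"
    using m by (simp add: card_image inj inj_place_big)
  then obtain b where b: "b < N" "\<And>i. i < m \<Longrightarrow> place (2 * N + i) \<noteq> place (2 * b)"
    by (metis (no_types, lifting) card_mono finite_imageI finite_lessThan image_eqI image_subsetI
        leD lessThan_iff)
  have "fits A adv ?n (place (2 * b))"
  proof (rule fits_if_content_subset[where S = "{2 * b, Suc (2 * b)}"])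
    show "bin_content A adv ?n (place (2 * b)) \<subseteq> {2 * b, Suc (2 * b)}"
    proof
      fix j assume "j \<in> bin_content A adv ?n (place (2 * b))"
      then have j: "j < ?n" "place j = place (2 * b)" using m by (auto simp: bin_content_adv)
      have "j < 2 * N"
      proof (rule ccontr)
        assume "\<not> j < 2 * N"
        then obtain i where "j = 2 * N + i" by (metis le_iff_add not_less)
        then show False using b(2)[of i] j by simp
      qed
      then have "j div 2 = b"
        using j(2) place_wave1[of j] b inj_place_big by (auto simp: inj_on_def)
      then show "j \<in> {2 * b, Suc (2 * b)}" by auto
    qed
    show "(\<Sum>j\<in>{2 * b, Suc (2 * b)}. item_size (adv ! j) $ i) + item_size (adv ! ?n) $ i \<le> 1" for i
      using m b pair_load[of b i] size_tiny[of ?n i] eta_small by (auto split: if_splits)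
  qed (use m b size_nonneg in auto)
  then obtain j where j: "j < ?n" "place ?n = place j"
    using place_used[of ?n "2 * b"] m b by auto
  \<comment> \<open>The chosen bin need not be that of the pair found by counting, but bins already
    holding a tiny item are excluded by \<open>new\<close>.\<close>
  then have "\<exists>b<N. place ?n = place (2 * b)"
  proof (cases "j < 2 * N")
    case True
    then have "j div 2 < N" "place ?n = place (2 * (j div 2))"
      using j place_wave1[of j] by auto
    then show ?thesis by blast
  next
    case False
    then obtain i where "j = 2 * N + i" by (metis le_iff_add not_less)
    then show ?thesis using new[of i] j by simp
  qed
  moreover have "place ?n \<notin> (\<lambda>i. place (2 * N + i)) ` {..<m}" using new by fastforce
  then have "inj_on (\<lambda>i. place (2 * N + i)) {..<Suc m}"
    using inj by (simp add: lessThan_Suc)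
  ultimately show ?case using old by (auto simp: less_Suc_eq)
qed

text \<open>An injective placement of N tiny items into N pair bins reaches every one of
  them.\<close>

lemma tiny_in_every_bin:
  assumes "b < N"
  shows "\<exists>i<N. place (2 * N + i) = place (2 * b)"
proof -
  have "(\<lambda>i. place (2 * N + i)) ` {..<N} = (\<lambda>b. place (2 * b)) ` {..<N}"
    using wave2[of N] inj_place_big by (intro card_subset_eq) (auto simp: card_image)
  then show ?thesis using assms by (force simp: set_eq_iff image_iff)
qed

section \<open>Lower bound on the cost\<close>

lemma span_bin_ge:
  assumes "b < N"
  shows "1 + \<mu> - \<tau> \<le> item_span {adv ! j | j. j < length adv \<and> place j = place (2 * b)}"
    (is "_ \<le> item_span ?S")
proof -
  obtain i where i: "i < N" "place (2 * N + i) = place (2 * b)"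
    using tiny_in_every_bin assms by blast
  have fin: "finite ?S" by simp
  have "adv_item (2 * b) \<in> ?S" using assms by (intro CollectI exI[of _ "2 * b"]) simp
  moreover have "adv_item (2 * N + i) \<in> ?S" using i by (intro CollectI exI[of _ "2 * N + i"]) simp
  \<comment> \<open>The big item lasts until 1 and the tiny one starts at 1 - \<tau>, so there is no
    gap between them.\<close>
  moreover have "{0..<1 + \<mu> - \<tau>} \<subseteq>
      active_interval (adv_item (2 * b)) \<union> active_interval (adv_item (2 * N + i))"
    using assms tau_pos tau_le_1 by (auto simp: active_interval_def arrival_departure_adv)
  ultimately have "{0..<1 + \<mu> - \<tau>} \<subseteq> (\<Union>r\<in>?S. active_interval r)" by blast
  \<comment> \<open>Finiteness matters, since \<open>measure\<close> is 0 on sets of infinite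
    measure and is monotone only below sets of finite measure.\<close>
  moreover have "(\<Union>r\<in>?S. active_interval r) \<in> fmeasurable lborel"
    using fin mu by (intro fmeasurable.finite_UN)
      (auto simp: active_interval_def fmeasurable_def arrival_departure_adv)
  ultimately have "measure lborel {0..<1 + \<mu> - \<tau>} \<le> item_span ?S"
    unfolding item_span_def by (intro measure_mono_fmeasurable) auto
  then show ?thesis using mu tau_pos tau_le_1 by (simp add: measure_def)
qed

lemma cost_ge: "real N * (1 + \<mu> - \<tau>) \<le> cost A adv"
proof -
  let ?sp = "\<lambda>b. item_span {adv ! j | j. j < length adv \<and> place j = b}"
  have "real N * (1 + \<mu> - \<tau>) \<le> (\<Sum>b<N. ?sp (place (2 * b)))"
    using sum_mono[of "{..<N}" "\<lambda>_. 1 + \<mu> - \<tau>" "\<lambda>b. ?sp (place (2 * b))"] span_bin_ge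
    by simp
  also have "\<dots> = (\<Sum>x\<in>(\<lambda>b. place (2 * b)) ` {..<N}. ?sp x)"
    using inj_place_big by (simp add: sum.reindex)
  also have "\<dots> \<le> (\<Sum>x\<in>place ` {..<length adv}. ?sp x)"
    by (intro sum_mono2) (auto simp: item_span_def)
  finally show ?thesis unfolding cost_def .
qed

section \<open>Upper bound on the optimum\<close>

lemma sum_coordinates:
  "(\<Sum>b\<in>{c * CARD('d)..<c * CARD('d) + CARD('d)}. f (g b)) = (\<Sum>i\<in>UNIV. f i)"
proof -
  have "(\<Sum>b\<in>{c * CARD('d)..<c * CARD('d) + CARD('d)}. f (g b)) = (\<Sum>r<CARD('d). f (g (c * CARD('d) + r)))"
    by (rule sum.reindex_bij_witness[of _ "\<lambda>r. c * CARD('d) + r" "\<lambda>b. b - c * CARD('d)"]) auto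
  also have "\<dots> = (\<Sum>r<CARD('d). f (h r))"
    by (intro sum.cong) (auto simp: g_def)
  also have "\<dots> = (\<Sum>i\<in>UNIV. f i)"
    using bij_h by (rule sum.reindex_bij_betw)
  finally show ?thesis .
qed

text \<open>Within a block, \<open>i\<close> is the own coordinate of exactly one pair.\<close>

lemma sum_own_coordinate:
  "(\<Sum>b\<in>{c * CARD('d)..<c * CARD('d) + CARD('d)}. if i = g b then x else y)
    = x + (real CARD('d) - 1) * y"
proof -
  have "(\<Sum>j\<in>(UNIV :: 'd set). if i = j then x else y) = (\<Sum>j\<in>UNIV. (if i = j then x - y else 0) + y)"
    by (intro sum.cong) auto
  also have "\<dots> = x + (real CARD('d) - 1) * y" by (simp add: sum.distrib algebra_simps)
  finally show ?thesis using sum_coordinates[where f = "\<lambda>j. if i = j then x else y"] by simp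
qed

text \<open>One item of size 1 - 3 D \<eta> and D - 1 items of size 2 \<eta> sum to 1 - D \<eta> - 2
  \<eta>.\<close>

lemma big_load:
  assumes "c < k"
  shows "(\<Sum>b\<in>{c * CARD('d)..<c * CARD('d) + CARD('d)}. item_size (adv_item (2 * b)) $ i) \<le> 1"
proof -
  have "c * CARD('d) + CARD('d) \<le> N"
    using assms mult_le_mono1[of "Suc c" k "CARD('d)"] by (simp add: N_def)
  then have "(\<Sum>b\<in>{c * CARD('d)..<c * CARD('d) + CARD('d)}. item_size (adv_item (2 * b)) $ i)
      = (\<Sum>b\<in>{c * CARD('d)..<c * CARD('d) + CARD('d)}.
           if i = g b then 1 - 3 * (\<eta> * real CARD('d)) else 2 * \<eta>)"
    by (intro sum.cong) (auto simp: size_big)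
  also have "\<dots> \<le> 1"
    unfolding sum_own_coordinate using eta_pos by (simp add: algebra_simps)
  finally show ?thesis .
qed

lemma filler_load: "(\<Sum>b<N. item_size (adv_item (Suc (2 * b))) $ i) \<le> 5 / 6"
proof -
  have "(\<Sum>b<N. item_size (adv_item (Suc (2 * b))) $ i)
      = (\<Sum>b<N. if i = g b then 3 * (\<eta> * real CARD('d)) - \<eta> else 2 * \<eta>)"
    by (intro sum.cong) (auto simp: size_filler)
  \<comment> \<open>Grouping the N fillers into k blocks, each of load 5 D \<eta> - 3 \<eta> in
    coordinate \<open>i\<close>.\<close>
  also have "\<dots> = (\<Sum>c<k. 3 * (\<eta> * real CARD('d)) - \<eta> + (real CARD('d) - 1) * (2 * \<eta>))"
    unfolding N_def sum.nat_group[symmetric] sum_own_coordinate ..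
  also have "\<dots> = 5 * (\<eta> * real k * real CARD('d)) - 3 * (\<eta> * real k)"
    by (simp add: algebra_simps)
  also have "\<dots> \<le> 5 / 6"
    unfolding eta_k_card using eta_pos by simp
  finally show ?thesis .
qed

lemma active_adv:
  "active_items adv t = {j. j < 3 * N \<and> t \<in> active_interval (adv_item j)}"
  unfolding active_items_def by auto

lemma rest_load: "(\<Sum>j\<in>{j. j < 2 * N \<and> odd j} \<union> {2 * N..<3 * N}. item_size (adv_item j) $ i) \<le> 1"
proof -
  have "{j. j < 2 * N \<and> odd j} = (\<lambda>b. Suc (2 * b)) ` {..<N}"
    by (auto elim!: oddE)
  then have "(\<Sum>j | j < 2 * N \<and> odd j. item_size (adv_item j) $ i) \<le> 5 / 6"
    using filler_load[of i] by (simp add: sum.reindex inj_on_def)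
  moreover have "(\<Sum>j\<in>{2 * N..<3 * N}. item_size (adv_item j) $ i) = (\<Sum>j\<in>{2 * N..<3 * N}. \<eta>)"
    by (intro sum.cong) (auto simp: size_tiny)
  moreover have "\<dots> = 1 / 6" using eta_N by (simp add: mult.commute)
  ultimately show ?thesis by (subst sum.union_disjoint) auto
qed

text \<open>The big item of pair j div 2 goes to the bin of its block, all fillers and tiny items go
  to bin k. The packing is feasible even for all items at once, hence for those active at any
  \<open>t\<close>.\<close>

lemma OPT_at_adv_le: "OPT_at adv t \<le> k + 1"
proof (rule OPT_at_le[where f = "\<lambda>j. if j < 2 * N \<and> even j then j div 2 div CARD('d) else k"])
  fix j assume "j \<in> active_items adv t"
  show "(if j < 2 * N \<and> even j then j div 2 div CARD('d) else k) < k + 1"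
    by (auto simp: N_def less_mult_imp_div_less intro!: less_SucI)
next
  fix c i assume c: "c < k + 1"
  let ?S = "{j \<in> active_items adv t. (if j < 2 * N \<and> even j then j div 2 div CARD('d) else k) = c}"
  have eq: "(\<Sum>j\<in>?S. item_size (adv ! j) $ i) = (\<Sum>j\<in>?S. item_size (adv_item j) $ i)"
    by (intro sum.cong) (auto simp: active_adv)
  show "(\<Sum>j\<in>?S. item_size (adv ! j) $ i) \<le> 1"
  proof (cases "c = k")
    case True
    have "j div 2 div CARD('d) < k" if "j < 2 * N" for j
      using that by (auto simp: N_def intro!: less_mult_imp_div_less)
    then have "\<not> (j < 2 * N \<and> even j)" if "j \<in> ?S" for j
      using that True by fastforce
    then have "?S \<subseteq> {j. j < 2 * N \<and> odd j} \<union> {2 * N..<3 * N}"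
      unfolding active_adv by fastforce
    then have "(\<Sum>j\<in>?S. item_size (adv_item j) $ i)
        \<le> (\<Sum>j\<in>{j. j < 2 * N \<and> odd j} \<union> {2 * N..<3 * N}. item_size (adv_item j) $ i)"
      by (intro sum_mono2) (auto simp: size_nonneg)
    then show ?thesis using rest_load[of i] eq by linarith
  next
    case False
    have "?S \<subseteq> (\<lambda>b. 2 * b) ` {c * CARD('d)..<c * CARD('d) + CARD('d)}" (is "_ \<subseteq> ?T")
    proof
      fix j assume "j \<in> ?S"
      then have j: "even j" "j div 2 div CARD('d) = c" using False by (auto split: if_splits)
      then have "j div 2 \<in> {c * CARD('d)..<c * CARD('d) + CARD('d)}"
        using div_times_less_eq_dividend[of "j div 2" "CARD('d)"]
          dividend_less_div_times[of "CARD('d)" "j div 2"] by auto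
      moreover have "j = 2 * (j div 2)" using j by simp
      ultimately show "j \<in> ?T" by blast
    qed
    then have "(\<Sum>j\<in>?S. item_size (adv_item j) $ i) \<le> (\<Sum>j\<in>?T. item_size (adv_item j) $ i)"
      by (intro sum_mono2) (auto simp: size_nonneg)
    also have "\<dots> \<le> 1" using big_load[of c i] c False by (simp add: sum.reindex inj_on_def)
    finally show ?thesis using eq by linarith
  qed
qed

text \<open>The big items are gone, and all that remains was in bin k of the previous
  packing.\<close>

lemma OPT_at_adv_late_le:
  assumes "t \<ge> 1"
  shows "OPT_at adv t \<le> 1"
proof (rule OPT_at_le[where f = "\<lambda>_. 0"])
  fix c :: nat and i assume "c < 1"
  let ?S = "{j \<in> active_items adv t. 0 = c}"
  have "?S \<subseteq> {j. j < 2 * N \<and> odd j} \<union> {2 * N..<3 * N}"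
    using assms by (auto simp: active_adv active_interval_def arrival_departure_adv)
  then have "(\<Sum>j\<in>?S. item_size (adv_item j) $ i)
      \<le> (\<Sum>j\<in>{j. j < 2 * N \<and> odd j} \<union> {2 * N..<3 * N}. item_size (adv_item j) $ i)"
    by (intro sum_mono2) (auto simp: size_nonneg)
  moreover have "(\<Sum>j\<in>?S. item_size (adv ! j) $ i) = (\<Sum>j\<in>?S. item_size (adv_item j) $ i)"
    by (intro sum.cong) (auto simp: active_adv)
  ultimately show "(\<Sum>j\<in>?S. item_size (adv ! j) $ i) \<le> 1"
    using rest_load[of i] by linarith
qed simp

lemma OPT_at_adv_outside:
  assumes "t < 0 \<or> t \<ge> 1 + \<mu>"
  shows "OPT_at adv t = 0"
proof -
  have "active_items adv t = {}"
    using assms mu tau_pos tau_le_1 by (auto simp: active_adv active_interval_def arrival_departure_adv)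
  then have "OPT_at adv t \<le> 0" by (intro OPT_at_le[where f = id]) auto
  then show ?thesis by simp
qed

lemma OPT_le: "OPT adv \<le> real k + 1 + \<mu>"
proof -
  \<comment> \<open>The end point 1 + \<mu> rounds up the last departure 1 - \<tau> + \<mu>.\<close>
  let ?F = "\<lambda>t. (real k + 1) * indicator {0..<1} t + indicator {1..<1 + \<mu>} t :: real"
  have int: "integrable lborel ?F" using mu by simp
  have "OPT adv \<le> (\<integral>t. ?F t \<partial>lborel)"
    unfolding OPT_def
  \<comment> \<open>Only the bounding function needs to be integrable: a nonintegrable integrand
    would have integral 0, which is still below that of the nonnegative \<open>?F\<close>.\<close>
  proof (rule integral_mono'[OF int])
    fix t
    show "real (OPT_at adv t) \<le> ?F t"
      using OPT_at_adv_le[of t] OPT_at_adv_late_le[of t] OPT_at_adv_outside[of t]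
      by (auto simp: indicator_def)
  qed auto
  also have "\<dots> = real k + 1 + \<mu>" using mu by simp
  finally show ?thesis .
qed

end

section \<open>The limit of large k\<close>

lemma any_fit_lower_bound_instance:
  fixes A :: "'d::finite algorithm"
  assumes "\<mu> \<ge> 1" and "any_fit_algorithm A" and "k > 0"
  shows "\<exists>R :: 'd item list. valid_instance R \<and> R \<noteq> [] \<and> duration_ratio R = \<mu> \<and>
    real CARD('d) * (real k * (1 + \<mu>) - 1) \<le> cost A R \<and> OPT R \<le> real k + 1 + \<mu>"
proof -
  obtain h where "bij_betw h {0..<CARD('d)} (UNIV :: 'd set)"
    using ex_bij_betw_nat_finite[OF finite] by blast
  then have h: "bij_betw h {..<CARD('d)} (UNIV :: 'd set)"
    by (simp only: atLeast0LessThan)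
  interpret any_fit_adversary A \<mu> k h
    by unfold_locales (fact assms h)+
  have "real CARD('d) * (real k * (1 + \<mu>) - 1) = real N * (1 + \<mu> - \<tau>)"
    using assms(3) by (simp add: N_def \<tau>_def field_simps)
  then show ?thesis
    using valid_adv adv_nonempty duration_ratio_adv cost_ge OPT_le by auto
qed

text \<open>Collecting the terms with k, the claim is c (1 + \<mu>) + d < k ((\<mu> + 1) d - c), and
  the coefficient of k is positive.\<close>

lemma competitive_bound_limit:
  fixes c d \<mu> :: real
  assumes "c < (\<mu> + 1) * d"
  shows "\<exists>k>0. c * (real k + 1 + \<mu>) < d * (real k * (1 + \<mu>) - 1)"
proof -
  obtain n where "(c * (1 + \<mu>) + d) / ((\<mu> + 1) * d - c) < real n"
    using reals_Archimedean2 by blast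
  then have "(c * (1 + \<mu>) + d) / ((\<mu> + 1) * d - c) < real (Suc n)" by simp
  then have "c * (1 + \<mu>) + d < real (Suc n) * ((\<mu> + 1) * d - c)"
    using assms by (simp only: pos_divide_less_eq diff_gt_0_iff_gt)
  then have "c * (real (Suc n) + 1 + \<mu>) < d * (real (Suc n) * (1 + \<mu>) - 1)"
    by (simp only: algebra_simps)
  then show ?thesis by blast
qed

theorem theorem4:
  fixes A :: "'d::finite algorithm" and \<mu> :: real
  assumes "\<mu> \<ge> 1"
    and "any_fit_algorithm A"
  shows "competitive_ratio A \<mu> \<ge> ereal ((\<mu> + 1) * real CARD('d)) \<and>
    (\<forall>\<delta>>0. \<exists>R :: 'd item list. valid_instance R \<and> R \<noteq> [] \<and> duration_ratio R = \<mu> \<and>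
       cost A R \<ge> ((\<mu> + 1) * real CARD('d) - \<delta>) * OPT R)"
proof -
  \<comment> \<open>Both claims follow once every constant below the bound is strictly exceeded on
    some instance.\<close>
  have beaten: "\<exists>R :: 'd item list. valid_instance R \<and> R \<noteq> [] \<and> duration_ratio R = \<mu> \<and>
      c * OPT R < cost A R" if c: "c < (\<mu> + 1) * real CARD('d)" for c
  proof -
    \<comment> \<open>For negative \<open>c\<close> an upper bound on \<open>OPT R\<close> would not
      bound \<open>c * OPT R\<close> from above, hence the passage to a nonnegative factor.\<close>
    have "max c 0 < (\<mu> + 1) * real CARD('d)" using c assms(1) by simp
    then obtain k where k: "k > 0"
      "max c 0 * (real k + 1 + \<mu>) < real CARD('d) * (real k * (1 + \<mu>) - 1)"
      using competitive_bound_limit by blast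
    obtain R :: "'d item list" where R: "valid_instance R" "R \<noteq> []" "duration_ratio R = \<mu>"
      "real CARD('d) * (real k * (1 + \<mu>) - 1) \<le> cost A R" "OPT R \<le> real k + 1 + \<mu>"
      using any_fit_lower_bound_instance[OF assms k(1)] by blast
    have "c * OPT R \<le> max c 0 * OPT R" using OPT_nonneg by (intro mult_right_mono) auto
    also have "\<dots> \<le> max c 0 * (real k + 1 + \<mu>)" using R(5) by (intro mult_left_mono) auto
    finally show ?thesis using R k(2) by (intro exI[of _ R]) auto
  qed
  have "ereal ((\<mu> + 1) * real CARD('d)) \<le> competitive_ratio A \<mu>"
    unfolding competitive_ratio_def
  proof (rule Inf_greatest, clarify)
    fix c assume "\<forall>R. valid_instance R \<and> R \<noteq> [] \<and> duration_ratio R = \<mu> \<longrightarrow> cost A R \<le> c * OPT R"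
    then have "\<not> c < (\<mu> + 1) * real CARD('d)" using beaten[of c] by force
    then show "ereal ((\<mu> + 1) * real CARD('d)) \<le> ereal c" by simp
  qed
  moreover have "\<exists>R :: 'd item list. valid_instance R \<and> R \<noteq> [] \<and> duration_ratio R = \<mu> \<and>
      cost A R \<ge> ((\<mu> + 1) * real CARD('d) - \<delta>) * OPT R" if "\<delta> > 0" for \<delta>
    using beaten[of "(\<mu> + 1) * real CARD('d) - \<delta>"] that by (auto intro: less_imp_le)
  ultimately show ?thesis by blast
qed

end
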